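(* Let $K$ be an infinite compact space and let $S$ be an infinite scattered compact space. Then the spaces $C_w(K)$ and $C_p(S)$ are not homeomorphic.
   Context: All topological spaces are assumed to be Tychonoff, so compact spaces are compact Hausdorff. For a compact space $K$, $C(K)$ denotes the Banach space of all real-valued continuous functions on $K$ with the supremum norm. $C_w(K)$ denotes the set $C(K)$ equipped with the weak topology of this Banach space (the weakest topology making all norm-continuous linear functionals on $C(K)$ continuous). $C_p(K)$ denotes the set $C(K)$ equipped with the pointwise topology, i.e. the topology inherited from the product space $\mathbb{R}^K$. A space $X$ is scattered if no nonempty subset $A\subseteq X$ is dense-in-itself (i.e. every nonempty subspace has an isolated point). *)

theory Defs
  imports "HOL-Analysis.Analysis"
begin

text \<open>
  A compact space is a type of class \<open>t2_space\<close> whose universe is compact; such a space is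
  normal, hence Tychonoff. For compact \<open>'k\<close> the library's Banach space \<open>'k \<Rightarrow>\<^sub>C real\<close> of bounded
  continuous functions, with the supremum norm, is $C(K)$, since boundedness is automatic:
\<close>

lemma bcontfun_compact_UNIV:
  assumes "compact (UNIV :: 'k::topological_space set)"
  shows "(bcontfun :: ('k \<Rightarrow> real) set) = {f. continuous_on UNIV f}"
  using assms by (auto simp: bcontfun_def intro: compact_imp_bounded compact_continuous_image)

text \<open>In the library \<open>bounded_linear f\<close> means that \<open>f\<close> is linear and norm-continuous.\<close>

definition weak_topology :: "'a::real_normed_vector topology" where
  "weak_topology =
     topology_generated_by {f -` U | (f :: 'a \<Rightarrow> real) U. bounded_linear f \<and> open U}"

lemma openin_weak_topology_vimage:
  fixes f :: "'a::real_normed_vector \<Rightarrow> real"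
  assumes "bounded_linear f" and "open U"
  shows "openin weak_topology (f -` U)"
  unfolding weak_topology_def by (rule topology_generated_by_Basis) (use assms in blast)

lemma topspace_weak_topology [simp]:
  "topspace (weak_topology :: 'a::real_normed_vector topology) = UNIV"
  using openin_subset[OF openin_weak_topology_vimage[OF bounded_linear_zero open_UNIV]] by auto

lemma continuous_map_weak_topology:
  fixes f :: "'a::real_normed_vector \<Rightarrow> real"
  assumes "bounded_linear f"
  shows "continuous_map weak_topology euclidean f"
  unfolding continuous_map_def
  using openin_weak_topology_vimage[OF assms] by (simp add: vimage_def)

lemma weak_topology_weakest:
  fixes T :: "'a::real_normed_vector topology"
  assumes "topspace T = UNIV"
    and cont: "\<And>f :: 'a \<Rightarrow> real. bounded_linear f \<Longrightarrow> continuous_map T euclidean f"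
    and V: "openin weak_topology V"
  shows "openin T V"
proof (rule generate_topology_on_coarsest[OF istopology_openin])
  show "generate_topology_on {f -` U | (f :: 'a \<Rightarrow> real) U. bounded_linear f \<and> open U} V"
    using V unfolding weak_topology_def by (rule openin_topology_generated_by)
  fix W assume "W \<in> {f -` U | (f :: 'a \<Rightarrow> real) U. bounded_linear f \<and> open U}"
  then obtain f :: "'a \<Rightarrow> real" and U where W: "W = f -` U" "bounded_linear f" "open U"
    by blast
  from openin_continuous_map_preimage[OF cont[OF W(2)], of U] W(1,3) assms(1)
  show "openin T W" by (simp add: vimage_def)
qed

definition pointwise_topology :: "('a::topological_space \<Rightarrow>\<^sub>C real) topology" where
  "pointwise_topology =
     pullback_topology UNIV apply_bcontfun (product_topology (\<lambda>_. euclidean) UNIV)"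

definition scattered :: "'a::topological_space set \<Rightarrow> bool" where
  "scattered X \<longleftrightarrow> (\<forall>A. A \<subseteq> X \<and> A \<noteq> {} \<longrightarrow> (\<exists>x. x isolated_in A))"

end

theory Submission
  imports Defs
begin

text \<open>
  For compact scattered \<open>S\<close> every point in the closure of a countable set \<open>A \<subseteq> C\<^sub>p(S)\<close> is the limit of a
  sequence in \<open>A\<close>: the functions in \<open>A\<close> factor through a compact metrizable quotient of \<open>S\<close>, and this
  quotient is countable because a perfect subset of it would pull back to a dense-in-itself subset
  of \<open>S\<close>.  This fails in \<open>C\<^sub>w(K)\<close> for infinite compact \<open>K\<close>, by von Neumann's example: if \<open>e\<^sub>0, e\<^sub>1, \<dots>\<close> are
  disjointly supported bumps, then \<open>0\<close> is in the weak closure of \<open>{e\<^sub>m + 2\<^sup>m e\<^sub>n}\<close>, as the bumps are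
  weakly null, but a combination of point evaluations shows that no sequence from this set is weakly
  null.
\<close>

section \<open>Scattered compact spaces\<close>

text \<open>\<open>P\<close> consists of the condensation points of \<open>T\<close> that lie in
  \<open>T\<close>. The basic open sets with countable trace on \<open>T\<close> are discarded;
  being countably many, they remove only countably many points, so an uncountable trace on
  \<open>T\<close> stays uncountable on \<open>P\<close>.\<close>

lemma uncountable_imp_condensation_point_set:
  fixes T :: "'a::second_countable_topology set"
  assumes "uncountable T"
  obtains P where "closedin (top_of_set T) P" "P \<noteq> {}"
    "\<And>U. open U \<Longrightarrow> U \<inter> P \<noteq> {} \<Longrightarrow> uncountable (U \<inter> P)"
proof -
  obtain \<B> :: "'a set set" where \<B>: "countable \<B>" "topological_basis \<B>"
    using ex_countable_basis by blast
  define \<N> where "\<N> = {B \<in> \<B>. countable (B \<inter> T)}"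
  define P where "P = T - \<Union>\<N>"
  have "countable \<N>"
    using \<B>(1) by (simp add: \<N>_def countable_Collect)
  then have "countable (\<Union>B\<in>\<N>. B \<inter> T)"
    by (rule countable_UN) (simp add: \<N>_def)
  then have rest: "countable (T - P)"
    by (rule countable_subset[rotated]) (auto simp: P_def)
  show thesis
  proof
    have "open (\<Union>\<N>)"
      using \<B>(2) by (auto simp: \<N>_def topological_basis_open)
    then show "closedin (top_of_set T) P"
      unfolding P_def by (metis Diff_eq closedin_closed_Int closed_Compl)
    show "P \<noteq> {}"
      using rest assms by auto
    fix U :: "'a set" assume U: "open U" "U \<inter> P \<noteq> {}"
    then obtain y where y: "y \<in> U" "y \<in> P" by blast
    obtain B where B: "B \<in> \<B>" "y \<in> B" "B \<subseteq> U"
      using topological_basisE[OF \<B>(2) U(1) y(1)] by blast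
    with y have "uncountable (B \<inter> T)"
      by (auto simp: P_def \<N>_def)
    moreover have "B \<inter> T \<subseteq> (U \<inter> P) \<union> (T - P)"
      using B(3) by blast
    ultimately show "uncountable (U \<inter> P)"
      using rest countable_Un countable_subset by metis
  qed
qed

text \<open>\<open>K - M\<close> is a minimal compact subset of \<open>K\<close> whose image still
  covers \<open>P\<close>. Phrasing minimality through the removed open sets makes the upper bound
  of a chain a union.\<close>

lemma ex_maximal_open_removable:
  fixes f :: "'a::t2_space \<Rightarrow> 'b::t2_space"
  assumes "compact K" "continuous_on K f" "P \<subseteq> f ` K"
  obtains M where "open M" "P \<subseteq> f ` (K - M)"
    "\<And>V. open V \<Longrightarrow> P \<subseteq> f ` (K - (M \<union> V)) \<Longrightarrow> V \<subseteq> M"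
proof -
  define \<A> where "\<A> = {U. open U \<and> P \<subseteq> f ` (K - U)}"
  have "\<exists>M\<in>\<A>. \<forall>X\<in>\<A>. M \<subseteq> X \<longrightarrow> X = M"
  proof (rule subset_Zorn_nonempty)
    show "\<A> \<noteq> {}"
      using assms(3) by (auto simp: \<A>_def intro!: exI[of _ "{}"])
    fix \<C> assume ne: "\<C> \<noteq> {}" and ch: "subset.chain \<A> \<C>"
    then have sub: "\<C> \<subseteq> \<A>" by (auto simp: subset.chain_def)
    \<comment> \<open>If the chain covered the fibre over \<open>y\<close>, compactness would leave
      finitely many members; the largest of them belongs to \<open>\<A>\<close> and yet contains the
      whole fibre.\<close>
    have "y \<in> f ` (K - \<Union>\<C>)" if y: "y \<in> P" for y
    proof (rule ccontr)
      assume "y \<notin> f ` (K - \<Union>\<C>)"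
      then have cover: "K \<inter> f -` {y} \<subseteq> \<Union>\<C>" by blast
      have "closed (K \<inter> f -` {y})"
        using assms(1,2) by (intro continuous_closed_preimage) (auto simp: compact_imp_closed)
      then have cpt: "compact (K \<inter> f -` {y})"
        using compact_Int_closed[OF assms(1), of "K \<inter> f -` {y}"] by simp
      have "\<And>B. B \<in> \<C> \<Longrightarrow> open B"
        using sub by (auto simp: \<A>_def)
      then obtain \<D> where \<D>: "\<D> \<subseteq> \<C>" "finite \<D>" "K \<inter> f -` {y} \<subseteq> \<Union>\<D>"
        using compactE[OF cpt cover] by metis
      have "\<D> \<noteq> {}"
        using \<D>(3) y assms(3) by blast
      moreover have "subset.chain \<A> \<D>"
        using ch \<D>(1) unfolding subset_chain_def by (meson subset_trans in_mono)
      ultimately have "\<Union>\<D> \<in> \<A>"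
        using Union_in_chain[OF \<D>(2)] \<D>(1) sub by blast
      then have "y \<in> f ` (K - \<Union>\<D>)"
        using y by (auto simp: \<A>_def)
      then obtain x where "x \<in> K" "x \<notin> \<Union>\<D>" "y = f x" by blast
      then show False
        using \<D>(3) by blast
    qed
    then show "\<Union>\<C> \<in> \<A>"
      using sub by (auto simp: \<A>_def)
  qed
  then obtain M where M: "M \<in> \<A>" "\<And>X. X \<in> \<A> \<Longrightarrow> M \<subseteq> X \<Longrightarrow> X = M" by blast
  show thesis
  proof
    show "open M" "P \<subseteq> f ` (K - M)"
      using M(1) by (auto simp: \<A>_def)
    fix V assume "open V" "P \<subseteq> f ` (K - (M \<union> V))"
    then have "M \<union> V \<in> \<A>"
      using M(1) by (auto simp: \<A>_def)
    then show "V \<subseteq> M"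
      using M(2) by blast
  qed
qed

text \<open>An uncountable image would contain a nonempty \<open>P\<close> all of whose nonempty
  relatively open parts are uncountable. Take a minimal compact \<open>K - M\<close> still covering
  \<open>P\<close>; scatteredness gives it an isolated point \<open>x\<close>. Discarding
  \<open>x\<close> can uncover at most the point \<open>f x\<close> of \<open>P\<close>, hence by
  uncountability no point at all, against minimality.\<close>

lemma countable_image_scattered_compact:
  fixes f :: "'a::t2_space \<Rightarrow> 'b::{second_countable_topology, t2_space}"
  assumes "compact K" "scattered K" "continuous_on K f"
  shows "countable (f ` K)"
proof (rule ccontr)
  assume "uncountable (f ` K)"
  then obtain P where P: "closedin (top_of_set (f ` K)) P" "P \<noteq> {}"
    "\<And>U. open U \<Longrightarrow> U \<inter> P \<noteq> {} \<Longrightarrow> uncountable (U \<inter> P)"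
    by (rule uncountable_imp_condensation_point_set) (rule that; assumption)
  have "P \<subseteq> f ` K"
    using closedin_imp_subset[OF P(1)] .
  then obtain M where M: "open M" "P \<subseteq> f ` (K - M)"
    "\<And>V. open V \<Longrightarrow> P \<subseteq> f ` (K - (M \<union> V)) \<Longrightarrow> V \<subseteq> M"
    by (rule ex_maximal_open_removable[OF assms(1,3)]) (rule that; assumption)
  have "K - M \<noteq> {}"
    using M(2) P(2) by blast
  then obtain x where "x isolated_in (K - M)"
    using assms(2) unfolding scattered_def by blast
  then obtain V where V: "open V" "V \<inter> (K - M) = {x}"
    unfolding isolated_in_def by blast
  have "compact (K - (M \<union> V))"
    using assms(1) M(1) V(1) by (intro compact_diff) auto
  moreover have "continuous_on (K - (M \<union> V)) f"
    using assms(3) by (rule continuous_on_subset) auto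
  \<comment> \<open>Closedness makes the uncovered part of \<open>P\<close> relatively open, so it
    is empty or uncountable.\<close>
  ultimately have closed: "closed (f ` (K - (M \<union> V)))"
    by (intro compact_imp_closed compact_continuous_image)
  have "y \<in> f ` (K - (M \<union> V))" if "y \<in> P" for y
  proof (rule ccontr)
    assume "y \<notin> f ` (K - (M \<union> V))"
    then have "uncountable (- f ` (K - (M \<union> V)) \<inter> P)"
      using P(3)[of "- f ` (K - (M \<union> V))"] closed that by (auto simp: open_Compl)
    \<comment> \<open>An uncovered point of \<open>P\<close> still has a preimage in
      \<open>K - M\<close>; this preimage must lie in \<open>V\<close>, so it is
      \<open>x\<close>.\<close>
    moreover have "- f ` (K - (M \<union> V)) \<inter> P \<subseteq> {f x}"
    proof
      fix z assume z: "z \<in> - f ` (K - (M \<union> V)) \<inter> P"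
      then obtain w where "w \<in> K - M" "z = f w"
        using M(2) by blast
      with z have "w \<in> V \<inter> (K - M)" by blast
      then show "z \<in> {f x}"
        using V(2) \<open>z = f w\<close> by simp
    qed
    ultimately show False
      by (meson countable_insert countable_empty countable_subset)
  qed
  then have "V \<subseteq> M"
    using M(3)[OF V(1)] by blast
  then show False
    using V(2) by blast
qed

section \<open>Convergence in the pointwise and weak topologies\<close>

lemma topspace_pointwise_topology [simp]: "topspace pointwise_topology = UNIV"
  by (simp add: pointwise_topology_def topspace_pullback_topology)

lemma limitin_pointwise_topology:
  "limitin pointwise_topology g l F \<longleftrightarrow> (\<forall>x. ((\<lambda>n. apply_bcontfun (g n) x) \<longlongrightarrow> apply_bcontfun l x) F)"
proof -
  have "limitin pointwise_topology g l F \<longleftrightarrow>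
      limitin (product_topology (\<lambda>_. euclidean) UNIV) (\<lambda>n. apply_bcontfun (g n)) (apply_bcontfun l) F"
    by (auto simp: limitin_def pointwise_topology_def openin_pullback_topology
        topspace_pullback_topology)
  also have "\<dots> \<longleftrightarrow> (\<forall>x. ((\<lambda>n. apply_bcontfun (g n) x) \<longlongrightarrow> apply_bcontfun l x) F)"
    by (simp add: limitin_componentwise)
  finally show ?thesis .
qed

lemma continuous_map_pointwise_topology_eval:
  "continuous_map pointwise_topology euclidean (\<lambda>g. apply_bcontfun g x)"
  unfolding pointwise_topology_def
  using continuous_map_pullback[OF continuous_map_product_projection, of x UNIV]
  by (simp add: o_def)

text \<open>For the converse it suffices to test subbasic open sets, since eventual membership
  passes to finite intersections and arbitrary unions.\<close>

lemma limitin_weak_topology: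
  "limitin weak_topology g l F \<longleftrightarrow>
    (\<forall>f :: 'a::real_normed_vector \<Rightarrow> real. bounded_linear f \<longrightarrow> ((\<lambda>n. f (g n)) \<longlongrightarrow> f l) F)"
proof (intro iffI allI impI)
  fix f :: "'a \<Rightarrow> real" assume "limitin weak_topology g l F" "bounded_linear f"
  then show "((\<lambda>n. f (g n)) \<longlongrightarrow> f l) F"
    using continuous_map_limit[OF continuous_map_weak_topology] by (fastforce simp: o_def)
next
  assume *: "\<forall>f :: 'a \<Rightarrow> real. bounded_linear f \<longrightarrow> ((\<lambda>n. f (g n)) \<longlongrightarrow> f l) F"
  have "l \<in> V \<Longrightarrow> eventually (\<lambda>n. g n \<in> V) F" if "openin weak_topology V" for V
    using openin_topology_generated_by[OF that[unfolded weak_topology_def]]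
  proof (induction rule: generate_topology_on.induct)
    case (Int A B)
    then show ?case by (simp add: eventually_conj)
  next
    case (UN \<K>)
    from UN.prems obtain X where "X \<in> \<K>" "l \<in> X" by blast
    then have "\<forall>\<^sub>F n in F. g n \<in> X"
      by (rule UN.IH)
    then show ?case
      by eventually_elim (use \<open>X \<in> \<K>\<close> in blast)
  next
    case (Basis S)
    then obtain f :: "'a \<Rightarrow> real" and U where "S = f -` U" "bounded_linear f" "open U" by blast
    then show ?case
      using * Basis.prems topological_tendstoD[of "\<lambda>n. f (g n)" "f l" F U] by simp
  qed simp
  then show "limitin weak_topology g l F"
    by (simp add: limitin_def)
qed

text \<open>Whether a sequence in \<open>A\<close> converges to \<open>g\<close> at \<open>x\<close>
  depends only on the value of \<open>\<Phi>\<close> at \<open>x\<close>. As \<open>\<Phi>\<close>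
  takes countably many values, countably many points \<open>t j\<close> decide convergence
  everywhere, and a diagonal choice from neighbourhoods of \<open>g\<close> gives the
  sequence.\<close>

lemma pointwise_closure_of_countable_sequential:
  fixes A :: "('s::t2_space \<Rightarrow>\<^sub>C real) set"
  assumes "compact (UNIV :: 's set)" "scattered (UNIV :: 's set)"
    and "countable A" "g \<in> pointwise_topology closure_of A"
  obtains \<sigma> where "range \<sigma> \<subseteq> A" "limitin pointwise_topology \<sigma> g sequentially"
proof -
  have "A \<noteq> {}"
    using assms(4) by auto
  then have A: "range (from_nat_into A) = A"
    using assms(3) by (rule range_from_nat_into)
  \<comment> \<open>The target is a countable power of the reals, hence second countable and
    Hausdorff, so the countability of continuous images applies.\<close>
  define \<Phi> :: "'s \<Rightarrow> nat \<Rightarrow> real" where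
    "\<Phi> = (\<lambda>x i. \<bar>from_nat_into A i x - g x\<bar>)"
  have "continuous_on UNIV \<Phi>"
    unfolding \<Phi>_def by (intro continuous_on_coordinatewise_then_product continuous_intros) auto
  then have "countable (range \<Phi>)"
    by (rule countable_image_scattered_compact[OF assms(1,2)])
  then have range: "range (from_nat_into (range \<Phi>)) = range \<Phi>"
    by (intro range_from_nat_into) auto
  then have "\<forall>j. \<exists>s. from_nat_into (range \<Phi>) j = \<Phi> s" by blast
  then obtain t where t_def: "\<And>j. from_nat_into (range \<Phi>) j = \<Phi> (t j)" by metis
  have t: "\<exists>j. \<Phi> x = \<Phi> (t j)" for x
  proof -
    have "\<Phi> x \<in> range (from_nat_into (range \<Phi>))"
      unfolding range by simp
    then show ?thesis
      by (auto simp: t_def)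
  qed
  \<comment> \<open>Stage \<open>n\<close> controls the first \<open>n + 1\<close> representatives
    with tolerance \<open>1 / (n + 1)\<close>, so each fixed \<open>t j\<close> is controlled from
    stage \<open>j\<close> on.\<close>
  have "\<exists>i. \<forall>j\<le>n. \<Phi> (t j) i < 1 / real (Suc n)" for n
  proof -
    define U where "U = (\<Inter>j\<in>{..n}. {h \<in> topspace pointwise_topology.
      apply_bcontfun h (t j) \<in> ball (apply_bcontfun g (t j)) (1 / real (Suc n))})"
    have "openin pointwise_topology U"
      unfolding U_def
      by (intro openin_INT2 openin_continuous_map_preimage[OF continuous_map_pointwise_topology_eval])
        auto
    moreover have "g \<in> U" by (auto simp: U_def)
    ultimately obtain a where "a \<in> A" "a \<in> U"
      using assms(4) unfolding in_closure_of by blast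
    moreover obtain i where "a = from_nat_into A i"
      using A \<open>a \<in> A\<close> by blast
    ultimately show ?thesis
      by (auto simp: U_def \<Phi>_def dist_real_def abs_minus_commute intro!: exI[of _ i])
  qed
  then obtain k where k: "\<And>n j. j \<le> n \<Longrightarrow> \<Phi> (t j) (k n) < 1 / real (Suc n)"
    by metis
  show thesis
  proof
    show "range (\<lambda>n. from_nat_into A (k n)) \<subseteq> A"
      using A by blast
    have "(\<lambda>n. from_nat_into A (k n) x) \<longlonglongrightarrow> g x" for x
    proof -
      obtain j where j: "\<Phi> x = \<Phi> (t j)"
        using t by blast
      have "\<forall>\<^sub>F n in sequentially. norm (from_nat_into A (k n) x - g x) \<le> 1 / real (Suc n)"
        using eventually_ge_at_top[of j]
      proof eventually_elim
        case (elim n)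
        then show ?case
          using k[of j n] fun_cong[OF j, of "k n"] by (simp add: \<Phi>_def)
      qed
      then have "(\<lambda>n. from_nat_into A (k n) x - g x) \<longlonglongrightarrow> 0"
        by (rule Lim_null_comparison) (rule LIMSEQ_Suc[OF lim_1_over_n])
      then show ?thesis
        by (simp add: LIM_zero_iff)
    qed
    then show "limitin pointwise_topology (\<lambda>n. from_nat_into A (k n)) g sequentially"
      by (simp add: limitin_pointwise_topology)
  qed
qed

section \<open>Failure in the weak topology\<close>

text \<open>Separate two points \<open>x\<close>, \<open>y\<close> of \<open>W\<close> by open sets
  \<open>X\<close>, \<open>Y\<close>. If \<open>W \<inter> X\<close> is infinite, it serves as the
  infinite piece. Otherwise removing its finitely many other points shows that \<open>{x}\<close> is
  open, and \<open>{x}\<close> is split off.\<close>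

lemma infinite_open_split:
  fixes W :: "'a::t2_space set"
  assumes "open W" "infinite W"
  obtains U V where "open U" "U \<noteq> {}" "U \<subseteq> W" "open V" "infinite V" "V \<subseteq> W" "U \<inter> V = {}"
proof -
  obtain x where "x \<in> W"
    using infinite_imp_nonempty[OF assms(2)] by blast
  have "W - {x} \<noteq> {}"
    using assms(2) by (metis finite.emptyI infinite_remove)
  then obtain y where "y \<in> W" "y \<noteq> x" by blast
  then obtain X Y where X: "open X" "x \<in> X" and Y: "open Y" "y \<in> Y" and XY: "X \<inter> Y = {}"
    using hausdorff[of x y] by metis
  show thesis
  proof (cases "infinite (W \<inter> X)")
    case True
    show thesis
      using that[of "W \<inter> Y" "W \<inter> X"] True assms(1) X Y XY \<open>y \<in> W\<close> by blast
  next
    case False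
    have "closed (W \<inter> X - {x})"
      using False by (simp add: finite_imp_closed)
    moreover have "{x} = (W \<inter> X) - (W \<inter> X - {x})"
      using X(2) \<open>x \<in> W\<close> by blast
    ultimately have "open {x}"
      using assms(1) X(1) by (metis open_Diff open_Int)
    then show thesis
      using that[of "{x}" "W - {x}"] assms \<open>x \<in> W\<close> by (auto simp: open_Diff)
  qed
qed

lemma ex_disjoint_open_sequence:
  assumes "infinite (UNIV :: 'a::t2_space set)"
  obtains U :: "nat \<Rightarrow> 'a::t2_space set"
  where "\<And>n. open (U n)" "\<And>n. U n \<noteq> {}" "\<And>m n. m \<noteq> n \<Longrightarrow> U m \<inter> U n = {}"
proof -
  \<comment> \<open>\<open>U\<close> is the set produced at a stage; \<open>W\<close> is an infinite
    reservoir disjoint from it, in which all later sets are found.\<close>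
  let ?P = "\<lambda>(U, W :: 'a set). open U \<and> U \<noteq> {} \<and> open W \<and> infinite W \<and> U \<inter> W = {}"
  have "\<exists>f. \<forall>n. ?P (f n) \<and> fst (f (Suc n)) \<subseteq> snd (f n) \<and> snd (f (Suc n)) \<subseteq> snd (f n)"
  proof (rule dependent_nat_choice)
    show "\<exists>p. ?P p"
    proof (rule infinite_open_split[OF open_UNIV assms])
      fix U V :: "'a set"
      assume "open U" "U \<noteq> {}" "open V" "infinite V" "U \<inter> V = {}"
      then show ?thesis by (intro exI[of _ "(U, V)"]) simp
    qed
    fix p assume "?P p"
    then have "open (snd p)" "infinite (snd p)" by auto
    then show "\<exists>q. ?P q \<and> fst q \<subseteq> snd p \<and> snd q \<subseteq> snd p"
    proof (rule infinite_open_split)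
      fix U V assume "open U" "U \<noteq> {}" "U \<subseteq> snd p" "open V" "infinite V" "V \<subseteq> snd p" "U \<inter> V = {}"
      then show ?thesis by (intro exI[of _ "(U, V)"]) simp
    qed
  qed
  then obtain f where
    chain: "\<forall>n. ?P (f n) \<and> fst (f (Suc n)) \<subseteq> snd (f n) \<and> snd (f (Suc n)) \<subseteq> snd (f n)"
    by (rule exE)
  have f: "?P (f n)" "fst (f (Suc n)) \<subseteq> snd (f n)" "snd (f (Suc n)) \<subseteq> snd (f n)" for n
    using spec[OF chain, of n] by simp_all
  have anti: "snd (f n) \<subseteq> snd (f m)" if "m \<le> n" for m n
    using lift_Suc_antimono_le[of "\<lambda>n. snd (f n)", OF f(3) that] .
  have lt: "fst (f m) \<inter> fst (f n) = {}" if "m < n" for m n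
  proof -
    obtain l where l: "n = Suc l" "m \<le> l"
      using \<open>m < n\<close> by (metis lessE less_Suc_eq_le)
    then have "fst (f n) \<subseteq> snd (f m)"
      using f(2)[of l] anti[of m l] by blast
    then show ?thesis
      using f(1)[of m] by (auto simp: case_prod_unfold)
  qed
  show thesis
  proof
    show "open (fst (f n))" "fst (f n) \<noteq> {}" for n
      using f(1)[of n] by (auto simp: case_prod_unfold)
    show "fst (f m) \<inter> fst (f n) = {}" if "m \<noteq> n" for m n
      using lt[of m n] lt[of n m] that by (cases m n rule: linorder_cases) auto
  qed
qed

lemma ex_disjoint_bump_sequence:
  assumes "compact (UNIV :: 'k::t2_space set)" "infinite (UNIV :: 'k set)"
  obtains e :: "nat \<Rightarrow> ('k::t2_space \<Rightarrow>\<^sub>C real)" and t :: "nat \<Rightarrow> 'k::t2_space"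
  where "\<And>n x. 0 \<le> apply_bcontfun (e n) x" "\<And>n x. apply_bcontfun (e n) x \<le> 1"
    "\<And>n. apply_bcontfun (e n) (t n) = 1"
    "\<And>m n x. m \<noteq> n \<Longrightarrow> apply_bcontfun (e m) x = 0 \<or> apply_bcontfun (e n) x = 0"
proof -
  obtain U :: "nat \<Rightarrow> 'k set" where U: "\<And>n. open (U n)" "\<And>n. U n \<noteq> {}"
    "\<And>m n. m \<noteq> n \<Longrightarrow> U m \<inter> U n = {}"
    by (rule ex_disjoint_open_sequence[OF assms(2)]) (rule that; assumption)
  define t where "t = (\<lambda>n. SOME x. x \<in> U n)"
  have t: "t n \<in> U n" for n
    using U(2) by (simp add: t_def some_in_eq)
  have "Hausdorff_space (euclidean :: 'k topology)"
    unfolding Hausdorff_space_def using hausdorff by (metis disjnt_def open_openin)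
  moreover have "compact_space (euclidean :: 'k topology)"
    using assms(1) by (simp add: compact_space_def)
  ultimately have normal: "normal_space (euclidean :: 'k topology)"
    by (simp add: compact_Hausdorff_or_regular_imp_normal_space)
  have "\<exists>e :: 'k \<Rightarrow>\<^sub>C real. (\<forall>x. 0 \<le> e x \<and> e x \<le> 1) \<and> e (t n) = 1 \<and> (\<forall>x. x \<notin> U n \<longrightarrow> e x = 0)" for n
  proof -
    obtain h where h: "continuous_map euclidean (top_of_set {0..1::real}) h"
      "h ` (- U n) \<subseteq> {0}" "h ` {t n} \<subseteq> {1}"
      using Urysohn_lemma[OF normal, of "- U n" "{t n}" 0 1] t U(1)
      by (auto simp: disjnt_def closed_Compl)
    have cont: "continuous_on UNIV h" and range: "\<And>x. h x \<in> {0..1}"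
      using h(1) by (auto simp: continuous_map_in_subtopology)
    have "h \<in> bcontfun"
      unfolding bcontfun_compact_UNIV[OF assms(1)] using cont by simp
    then have "apply_bcontfun (Bcontfun h) = h"
      by (rule Bcontfun_inverse)
    then show ?thesis
      using h(2,3) range by (intro exI[of _ "Bcontfun h"]) auto
  qed
  then obtain e :: "nat \<Rightarrow> ('k \<Rightarrow>\<^sub>C real)" where e: "\<And>n x. 0 \<le> e n x \<and> e n x \<le> 1"
    "\<And>n. e n (t n) = 1" "\<And>n x. x \<notin> U n \<Longrightarrow> e n x = 0" by metis
  show thesis
    by (rule that[of e t]) (use e U(3) in blast)+
qed

text \<open>Disjoint supports keep the supremum norm of every signed sum of bumps at most 1. Hence
  the values of a functional on the bumps are absolutely summable and tend to 0.\<close>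

lemma disjoint_bumps_weakly_null:
  fixes e :: "nat \<Rightarrow> ('k::topological_space \<Rightarrow>\<^sub>C real)"
  assumes bound: "\<And>n x. \<bar>apply_bcontfun (e n) x\<bar> \<le> 1"
    and disj: "\<And>m n x. m \<noteq> n \<Longrightarrow> apply_bcontfun (e m) x = 0 \<or> apply_bcontfun (e n) x = 0"
  shows "limitin weak_topology e 0 sequentially"
  unfolding limitin_weak_topology
proof (intro allI impI)
  fix f :: "('k \<Rightarrow>\<^sub>C real) \<Rightarrow> real" assume f: "bounded_linear f"
  interpret bounded_linear f by fact
  obtain B where B: "B \<ge> 0" "\<And>x. norm (f x) \<le> norm x * B"
    using nonneg_bounded by blast
  have "(\<Sum>i<N. \<bar>f (e i)\<bar>) \<le> B" for N
  proof -
    \<comment> \<open>The signs turn \<open>f u\<close> into the sum of the absolute values, while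
      at each point at most one summand is nonzero.\<close>
    define u where "u = (\<Sum>i<N. sgn (f (e i)) *\<^sub>R e i)"
    have "norm u \<le> 1"
    proof (rule norm_bound)
      fix x
      have ux: "u x = (\<Sum>i<N. sgn (f (e i)) * e i x)"
        unfolding u_def by (induction N) auto
      show "norm (u x) \<le> 1"
      proof (cases "\<exists>i<N. e i x \<noteq> 0")
        case True
        then obtain i where i: "i < N" "e i x \<noteq> 0" by blast
        have "u x = (\<Sum>j\<in>{i}. sgn (f (e j)) * e j x)"
          unfolding ux using i disj by (intro sum.mono_neutral_right) auto
        then show ?thesis
          using bound[of i x] by (auto simp: abs_mult sgn_if)
      next
        case False
        then show ?thesis by (simp add: ux)
      qed
    qed
    have "(\<Sum>i<N. \<bar>f (e i)\<bar>) = f u"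
      by (simp add: u_def sum scaleR abs_sgn mult.commute)
    also have "\<dots> \<le> norm u * B"
      using B(2)[of u] by simp
    also have "\<dots> \<le> B"
      using \<open>norm u \<le> 1\<close> B(1) by (simp add: mult_left_le_one_le)
    finally show ?thesis .
  qed
  then have "summable (\<lambda>i. \<bar>f (e i)\<bar>)"
    by (intro summableI_nonneg_bounded[where x = B]) auto
  then show "(\<lambda>n. f (e n)) \<longlonglongrightarrow> f 0"
    using summable_LIMSEQ_zero tendsto_rabs_zero_iff by (fastforce simp: zero)
qed

section \<open>Functionals built from point evaluations\<close>

lemma abs_apply_bcontfun_le_norm:
  fixes g :: "'a::topological_space \<Rightarrow>\<^sub>C real"
  shows "\<bar>apply_bcontfun g x\<bar> \<le> norm g"
  using norm_bounded[of g x] by simp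

lemma bounded_linear_eval: "bounded_linear (\<lambda>g :: 'a::topological_space \<Rightarrow>\<^sub>C real. apply_bcontfun g x)"
  by (rule bounded_linear_intro[where K = 1]) (auto simp: abs_apply_bcontfun_le_norm)

lemma summable_eval_series:
  fixes g :: "'a::topological_space \<Rightarrow>\<^sub>C real"
  shows "summable (\<lambda>j. (1/2)^j * apply_bcontfun g (s j))"
proof (rule summable_comparison_test')
  show "summable (\<lambda>j. (1/2)^j * norm g)"
    by (intro summable_mult2 summable_geometric) simp
  show "norm ((1/2)^j * apply_bcontfun g (s j)) \<le> (1/2)^j * norm g" for j
    by (simp add: abs_mult abs_apply_bcontfun_le_norm divide_right_mono power_one_over)
qed

text \<open>This is integration against the sum of point masses \<open>(1/2)^j\<close> at
  \<open>s j\<close>, of total mass 2 (whence the bound). It is a single functional that sees a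
  whole sequence of points.\<close>

lemma bounded_linear_eval_series:
  "bounded_linear (\<lambda>g :: 'a::topological_space \<Rightarrow>\<^sub>C real. \<Sum>j. (1/2)^j * apply_bcontfun g (s j))"
proof (rule bounded_linear_intro[where K = 2])
  fix g h :: "'a \<Rightarrow>\<^sub>C real" and r :: real
  show "(\<Sum>j. (1/2)^j * apply_bcontfun (g + h) (s j)) =
      (\<Sum>j. (1/2)^j * apply_bcontfun g (s j)) + (\<Sum>j. (1/2)^j * apply_bcontfun h (s j))"
    by (simp add: distrib_left suminf_add summable_eval_series)
  show "(\<Sum>j. (1/2)^j * apply_bcontfun (r *\<^sub>R g) (s j)) =
      r *\<^sub>R (\<Sum>j. (1/2)^j * apply_bcontfun g (s j))"
    using suminf_mult[OF summable_eval_series, of r g s] by (simp add: mult.left_commute)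
  have "norm (\<Sum>j. (1/2)^j * apply_bcontfun g (s j)) \<le> (\<Sum>j. (1/2)^j * norm g)"
    by (intro norm_suminf_le summable_mult2 summable_geometric)
      (auto simp: abs_mult abs_apply_bcontfun_le_norm divide_right_mono power_one_over)
  also have "\<dots> = norm g * 2"
    using suminf_mult2[of "\<lambda>j. (1/2::real)^j" "norm g"] suminf_geometric[of "1/2 :: real"] by simp
  finally show "norm (\<Sum>j. (1/2)^j * apply_bcontfun g (s j)) \<le> norm g * 2" .
qed

lemma weak_closure_of_countable_not_sequential:
  assumes "compact (UNIV :: 'k::t2_space set)" "infinite (UNIV :: 'k set)"
  obtains A :: "('k::t2_space \<Rightarrow>\<^sub>C real) set" where "countable A" "0 \<in> weak_topology closure_of A"
    "\<nexists>\<sigma>. range \<sigma> \<subseteq> A \<and> limitin weak_topology \<sigma> 0 sequentially"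
proof -
  obtain e :: "nat \<Rightarrow> ('k \<Rightarrow>\<^sub>C real)" and t where
    e: "\<And>n x. 0 \<le> e n x" "\<And>n x. e n x \<le> 1" "\<And>n. e n (t n) = 1"
    and disj: "\<And>m n x. m \<noteq> n \<Longrightarrow> e m x = 0 \<or> e n x = 0"
    by (rule ex_disjoint_bump_sequence[OF assms]) (rule that; assumption)
  have null: "limitin weak_topology e 0 sequentially"
    by (rule disjoint_bumps_weakly_null) (use e disj in auto)
  define a where "a = (\<lambda>m n. e m + 2^m *\<^sub>R e n)"
  define A where "A = range (case_prod a)"
  show thesis
  proof
    show "countable A" by (simp add: A_def)
    show "0 \<in> weak_topology closure_of A"
      unfolding in_closure_of
    proof (intro conjI allI impI)
      fix U :: "('k \<Rightarrow>\<^sub>C real) set" assume U: "0 \<in> U \<and> openin weak_topology U"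
      \<comment> \<open>An iterated limit: \<open>U\<close> contains some \<open>e m\<close>, and
        being open it then contains \<open>a m n\<close> for large \<open>n\<close>.\<close>
      then have "\<forall>\<^sub>F m in sequentially. e m \<in> U"
        using null by (simp add: limitin_def)
      then obtain m where m: "e m \<in> U"
        by (auto simp: eventually_sequentially)
      have "limitin weak_topology (a m) (e m) sequentially"
        unfolding limitin_weak_topology
      proof (intro allI impI)
        fix f :: "('k \<Rightarrow>\<^sub>C real) \<Rightarrow> real" assume f: "bounded_linear f"
        interpret bounded_linear f by fact
        have "(\<lambda>n. f (e n)) \<longlonglongrightarrow> 0"
          using null f zero unfolding limitin_weak_topology by metis
        then have "(\<lambda>n. f (e m) + 2^m * f (e n)) \<longlonglongrightarrow> f (e m) + 2^m * 0"
          by (intro tendsto_intros)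
        then show "(\<lambda>n. f (a m n)) \<longlonglongrightarrow> f (e m)"
          by (simp add: a_def add scaleR)
      qed
      then have "\<forall>\<^sub>F n in sequentially. a m n \<in> U"
        using m U by (simp add: limitin_def)
      then show "\<exists>y. y \<in> A \<and> y \<in> U"
        by (auto simp: A_def eventually_sequentially)
    qed simp
    show "\<nexists>\<sigma>. range \<sigma> \<subseteq> A \<and> limitin weak_topology \<sigma> 0 sequentially"
    proof safe
      fix \<sigma> :: "nat \<Rightarrow> ('k \<Rightarrow>\<^sub>C real)"
      assume \<sigma>: "range \<sigma> \<subseteq> A" and lim: "limitin weak_topology \<sigma> 0 sequentially"
      have "\<exists>m n. \<sigma> k = a m n" for k
      proof -
        have "\<sigma> k \<in> A" using \<sigma> by blast
        then show ?thesis by (auto simp: A_def)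
      qed
      then obtain p q where pq: "\<And>k. \<sigma> k = a (p k) (q k)" by metis
      have eval: "\<sigma> k x = e (p k) x + 2 ^ p k * e (q k) x" for k x
        by (simp add: pq a_def)
      then have nonneg: "0 \<le> \<sigma> k x" for k x
        by (simp add: e(1))
      \<comment> \<open>Each first index is left eventually: if \<open>p k = m\<close>, the value of
        \<open>\<sigma> k\<close> at the peak \<open>t m\<close> is at least 1.\<close>
      have "\<forall>\<^sub>F k in sequentially. p k \<noteq> m" for m
      proof -
        have "(\<lambda>k. \<sigma> k (t m)) \<longlonglongrightarrow> 0"
          using lim bounded_linear_eval[of "t m"] unfolding limitin_weak_topology by fastforce
        then have "\<forall>\<^sub>F k in sequentially. \<sigma> k (t m) < 1"
          by (rule order_tendstoD) simp
        then show ?thesis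
        proof eventually_elim
          case (elim k)
          show ?case
          proof
            assume "p k = m"
            then have "\<sigma> k (t m) \<ge> 1"
              using e(1)[of "q k" "t m"] by (simp add: eval e(3))
            then show False using elim by simp
          qed
        qed
      qed
      then have "\<forall>\<^sub>F k in sequentially. \<forall>m<j. p k \<noteq> m" for j
        using eventually_ball_finite[of "{..<j}" "\<lambda>k m. p k \<noteq> m" sequentially] by (simp add: Ball_def)
      then have "\<exists>k\<ge>j. \<forall>m<j. p k \<noteq> m" for j
        unfolding eventually_sequentially by (metis linorder_linear)
      \<comment> \<open>The bound \<open>k \<ge> j\<close> places the chosen terms arbitrarily far
        out in the sequence; the bound on \<open>p k\<close> makes the coefficient at least
        \<open>2 ^ j\<close>.\<close>
      then have "\<exists>k\<ge>j. p k \<ge> j" for j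
        by (metis not_le)
      then obtain k where k: "\<And>j. j \<le> k j" "\<And>j. j \<le> p (k j)" by metis
      \<comment> \<open>The coefficient \<open>2 ^ p (k j)\<close> cancels the weight \<open>(1/2)^j\<close> of the matching evaluation, and the
        remaining terms are nonnegative.\<close>
      define \<beta> :: "('k \<Rightarrow>\<^sub>C real) \<Rightarrow> real" where
        "\<beta> = (\<lambda>g. \<Sum>j. (1/2)^j * apply_bcontfun g (t (q (k j))))"
      have "\<beta> (\<sigma> (k j)) \<ge> 1" for j
      proof -
        have "(2::real) ^ j \<le> 2 ^ p (k j)"
          using k(2) by (intro power_increasing) auto
        also have "\<dots> \<le> \<sigma> (k j) (t (q (k j)))"
          by (simp add: eval e(1,3))
        finally have "(1/2)^j * 2^j \<le> (1/2)^j * \<sigma> (k j) (t (q (k j)))"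
          by (intro mult_left_mono) auto
        then have "1 \<le> (\<Sum>i\<in>{j}. (1/2)^i * \<sigma> (k j) (t (q (k i))))"
          by (simp add: power_one_over)
        also have "\<dots> \<le> \<beta> (\<sigma> (k j))"
          unfolding \<beta>_def by (intro sum_le_suminf summable_eval_series) (auto simp: nonneg)
        finally show ?thesis .
      qed
      moreover have "bounded_linear \<beta>"
        unfolding \<beta>_def by (rule bounded_linear_eval_series)
      then have "(\<lambda>n. \<beta> (\<sigma> n)) \<longlonglongrightarrow> 0"
        using lim linear_simps(3) unfolding limitin_weak_topology by metis
      then have "\<forall>\<^sub>F n in sequentially. \<beta> (\<sigma> n) < 1"
        by (rule order_tendstoD) simp
      then obtain N where "\<And>n. n \<ge> N \<Longrightarrow> \<beta> (\<sigma> n) < 1"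
        by (auto simp: eventually_sequentially)
      then have "\<beta> (\<sigma> (k N)) < 1"
        using k(1) by blast
      ultimately show False
        by (meson not_le)
    qed
  qed
qed

section \<open>Transporting the counterexample through a homeomorphism\<close>

theorem corollary5p11:
  assumes "compact (UNIV :: 'k::t2_space set)"
    and "infinite (UNIV :: 'k set)"
    and "compact (UNIV :: 's::t2_space set)"
    and "infinite (UNIV :: 's set)"
    and "scattered (UNIV :: 's set)"
  shows "\<not> (weak_topology :: ('k \<Rightarrow>\<^sub>C real) topology) homeomorphic_space
           (pointwise_topology :: ('s \<Rightarrow>\<^sub>C real) topology)"
proof
  assume "(weak_topology :: ('k \<Rightarrow>\<^sub>C real) topology) homeomorphic_space
           (pointwise_topology :: ('s \<Rightarrow>\<^sub>C real) topology)"
  then obtain h :: "('k \<Rightarrow>\<^sub>C real) \<Rightarrow> ('s \<Rightarrow>\<^sub>C real)" and h'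
    where h: "continuous_map weak_topology pointwise_topology h"
      and h': "continuous_map pointwise_topology weak_topology h'"
      and inv: "\<And>x. h' (h x) = x"
    unfolding homeomorphic_space_def homeomorphic_maps_def by auto
  obtain A :: "('k \<Rightarrow>\<^sub>C real) set" where A: "countable A" "0 \<in> weak_topology closure_of A"
    "\<nexists>\<sigma>. range \<sigma> \<subseteq> A \<and> limitin weak_topology \<sigma> 0 sequentially"
    by (rule weak_closure_of_countable_not_sequential[OF assms(1,2)])
  \<comment> \<open>Countability and closure points survive under \<open>h\<close>, so sequences
    suffice on the pointwise side; \<open>h'\<close> carries the sequence found there back into
    \<open>A\<close>.\<close>
  have "h 0 \<in> pointwise_topology closure_of h ` A"
    using continuous_map_image_closure_subset[OF h] A(2) by blast
  then obtain \<sigma> where \<sigma>: "range \<sigma> \<subseteq> h ` A" "limitin pointwise_topology \<sigma> (h 0) sequentially"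
    by (rule pointwise_closure_of_countable_sequential[OF assms(3,5) countable_image[OF A(1)]])
  have "limitin weak_topology (h' \<circ> \<sigma>) 0 sequentially"
    using continuous_map_limit[OF h' \<sigma>(2)] by (simp add: inv)
  moreover have "range (h' \<circ> \<sigma>) \<subseteq> A"
    using \<sigma>(1) by (fastforce simp: inv)
  ultimately show False
    using A(3) by blast
qed

end
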